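(* Let $k\ge1$ and $\sigma,\tau\in\mathcal{P}(k)$ be fixed, and put $d=|D(\sigma\vee\tau)|$. Then, as $N\to\infty$, $$\mathring{\mathrm{Wg}}_k(\sigma,\tau,N)=\widetilde{\mathring{\mathrm{Wg}}}_k(\sigma,\tau,N)\,\bigl(1+O(N^{-1})\bigr),$$ where the leading term $\widetilde{\mathring{\mathrm{Wg}}}_k(\sigma,\tau,N)$ is given as follows. (1) If $d=k$, which means that $\sigma=\tau=0_k$, then $\widetilde{\mathring{\mathrm{Wg}}}_k(\sigma,\tau,N)=\tilde a_k(N)$. (2) If $d$ is even and $d\ne k$, then $$\widetilde{\mathring{\mathrm{Wg}}}_k(\sigma,\tau,N)=\mu(\sigma\wedge\tau,\sigma)\,\mu(\sigma\wedge\tau,\tau)\,(d-1)!!\;N^{-\left(\#(\sigma\wedge\tau)+\frac d2\right)}.$$ (3) If $d$ is odd and $d\ne k$, then $$\widetilde{\mathring{\mathrm{Wg}}}_k(\sigma,\tau,N)=\mu(\sigma\wedge\tau,\sigma)\,\mu(\sigma\wedge\tau,\tau)\left(\#(\sigma\wedge\tau)-\tfrac d3-\tfrac23\right)d!!\;N^{-\left(\#(\sigma\wedge\tau)+\frac{d+1}{2}\right)}.$$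
   Context: $\mathcal{P}(k)$ is the lattice of set partitions of $[k]=\{1,\dots,k\}$, ordered by refinement: $\pi_1\le\pi_2$ iff every block of $\pi_1$ is contained in a block of $\pi_2$; $\wedge$ and $\vee$ are meet and join; $0_k=\{\{1\},\dots,\{k\}\}$ is the minimum. $\#\pi$ is the number of blocks of $\pi$, and $D(\pi)=\{j\in[k]:\{j\}\text{ is a block of }\pi\}$. For $\pi_1\le\pi_2$, if the blocks $B_1,\dots,B_r$ of $\pi_2$ are split into $\lambda_1,\dots,\lambda_r$ blocks of $\pi_1$ respectively, then $\mu(\pi_1,\pi_2)=\prod_{i=1}^{r}(-1)^{\lambda_i-1}(\lambda_i-1)!$. $(x)_n=x(x-1)\cdots(x-n+1)$ with $(x)_0=1$. For a positive odd integer $n$, $n!!=\prod_{m=1}^{(n+1)/2}(2m-1)$, and $(-1)!!=1$. For $N\ge k$, the centered Weingarten function is $$\mathring{\mathrm{Wg}}_k(\sigma,\tau,N)=\sum_{i=0}^{|D(\sigma\vee\tau)|}\binom{|D(\sigma\vee\tau)|}{i}(-1)^i\sum_{\pi\in\mathcal{P}(k),\ \pi\le\sigma\wedge\tau}\mu(\pi,\sigma)\,\mu(\pi,\tau)\,N^{-i}\,\frac{1}{(N)_{\#\pi-i}}.$$ Finally, $\tilde a_k(N)=(2k'-1)!!\,N^{-3k'}$ if $k=2k'$, and $\tilde a_k(N)=\frac{4k'}{3}(2k'+1)!!\,N^{-3k'-2}$ if $k=2k'+1$ (so $\tilde a_1(N)=0$, in which case the asymptotic relation reads $\mathring{\mathrm{Wg}}_1=0$).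 The implied constant in $O(N^{-1})$ may depend on $k,\sigma,\tau$. *)

theory Defs
  imports
    Complex_Main
    "HOL-Library.Disjoint_Sets"
    "HOL-Library.Landau_Symbols"
    "HOL-Algebra.Lattice"
begin

definition set_partitions :: "nat \<Rightarrow> nat set set gorder" where
  "set_partitions k =
     \<lparr>carrier = {\<pi>. partition_on {1..k} \<pi>}, eq = (=), le = refines {1..k}\<rparr>"

text \<open>
  The operations \<open>\<sqinter>\<close> and \<open>\<squnion>\<close> of HOL-Algebra are choice-based greatest lower and
  least upper bounds; they are well defined here because \<open>set_partitions k\<close> is a lattice.
\<close>

lemma lattice_set_partitions: "lattice (set_partitions k)"
proof -
  let ?L = "set_partitions k" and ?A = "{1..k}"
  have car: "x \<in> carrier ?L \<longleftrightarrow> partition_on ?A x" for x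
    by (simp add: set_partitions_def)
  have le: "x \<sqsubseteq>\<^bsub>?L\<^esub> y \<longleftrightarrow> refines ?A x y" for x y
    by (simp add: set_partitions_def)
  have eq: "x .=\<^bsub>?L\<^esub> y \<longleftrightarrow> x = y" for x y
    by (simp add: set_partitions_def)
  have po: "partial_order ?L"
  proof unfold_locales
    fix x y assume "x \<sqsubseteq>\<^bsub>?L\<^esub> y" "y \<sqsubseteq>\<^bsub>?L\<^esub> x"
    then show "x .=\<^bsub>?L\<^esub> y"
      unfolding le eq by (rule refines_asym)
  next
    fix x y z assume "x \<sqsubseteq>\<^bsub>?L\<^esub> y" "y \<sqsubseteq>\<^bsub>?L\<^esub> z"
    then show "x \<sqsubseteq>\<^bsub>?L\<^esub> z"
      unfolding le by (rule refines_trans)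
  qed (simp_all add: set_partitions_def refines_refl)
  have inf: "greatest ?L (common_refinement Q) (Lower ?L Q)"
    if Q: "\<And>x. x \<in> Q \<Longrightarrow> partition_on ?A x" "Q \<noteq> {}" for Q
    unfolding greatest_def Lower_def
  proof (intro conjI ballI)
    show "common_refinement Q \<in> {l. \<forall>x. x \<in> Q \<inter> carrier ?L \<longrightarrow> l \<sqsubseteq>\<^bsub>?L\<^esub> x} \<inter> carrier ?L"
      using partition_on_common_refinement[OF Q] refines_common_refinement[OF Q(1)]
      by (simp add: car le)
  next
    fix x assume "x \<in> {l. \<forall>x. x \<in> Q \<inter> carrier ?L \<longrightarrow> l \<sqsubseteq>\<^bsub>?L\<^esub> x} \<inter> carrier ?L"
    then have "partition_on ?A x" "\<And>q. q \<in> Q \<Longrightarrow> refines ?A x q"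
      using Q(1) by (simp_all add: car le)
    then show "x \<sqsubseteq>\<^bsub>?L\<^esub> common_refinement Q"
      unfolding le using common_refinement_coarsest Q by metis
  qed blast
  have top: "partition_on ?A ({?A} - {{}})"
    by (simp add: partition_on_def disjoint_def) blast
  have le_top: "refines ?A x ({?A} - {{}})" if x: "partition_on ?A x" for x
    unfolding refines_def
  proof (intro conjI ballI x top)
    fix X assume "X \<in> x"
    then have "X \<subseteq> ?A" "X \<noteq> {}"
      using x by (auto simp only: partition_on_def)
    then show "\<exists>Y\<in>{?A} - {{}}. X \<subseteq> Y"
      by blast
  qed
  interpret partial_order ?L by (rule po)
  show ?thesis
  proof unfold_locales
    fix x y assume xy: "x \<in> carrier ?L" "y \<in> carrier ?L"
    have "greatest ?L (common_refinement {x, y}) (Lower ?L {x, y})"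
      by (rule inf) (use xy car in blast)+
    then show "\<exists>s. greatest ?L s (Lower ?L {x, y})" ..
    let ?U = "Upper ?L {x, y}"
    have "{?A} - {{}} \<in> ?U"
      unfolding Upper_def using xy top le_top by (simp add: car le)
    then have g: "greatest ?L (common_refinement ?U) (Lower ?L ?U)"
      by (intro inf) (use car in \<open>auto simp only: Upper_def\<close>)
    have lower: "x \<in> Lower ?L ?U" "y \<in> Lower ?L ?U"
      using xy unfolding Lower_def Upper_def by blast+
    let ?c = "common_refinement ?U"
    have "?c \<in> carrier ?L" "x \<sqsubseteq>\<^bsub>?L\<^esub> ?c" "y \<sqsubseteq>\<^bsub>?L\<^esub> ?c"
      using g lower unfolding greatest_def Lower_def by blast+
    then have "?c \<in> ?U"
      unfolding Upper_def by blast
    moreover have "?c \<sqsubseteq>\<^bsub>?L\<^esub> u" if "u \<in> ?U" for u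
      using g that unfolding greatest_def Lower_def Upper_def by blast
    ultimately have "least ?L ?c ?U"
      unfolding least_def by simp
    then show "\<exists>s. least ?L s ?U" ..
  qed
qed

definition zero_partition :: "nat \<Rightarrow> nat set set" where
  "zero_partition k = (\<lambda>j. {j}) ` {1..k}"

definition singletons_of :: "nat \<Rightarrow> nat set set \<Rightarrow> nat set" where
  "singletons_of k \<pi> = {j \<in> {1..k}. {j} \<in> \<pi>}"

text \<open>Only meaningful when the first argument refines the second.\<close>

definition moebius :: "nat set set \<Rightarrow> nat set set \<Rightarrow> real" where
  "moebius \<pi>\<^sub>1 \<pi>\<^sub>2 =
     (\<Prod>B\<in>\<pi>\<^sub>2. let l = card {C \<in> \<pi>\<^sub>1. C \<subseteq> B} in (-1) ^ (l - 1) * fact (l - 1))"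

definition falling_fact :: "real \<Rightarrow> nat \<Rightarrow> real" where
  "falling_fact x n = (\<Prod>j<n. x - real j)"

text \<open>Odd double factorial: for odd \<open>n \<ge> -1\<close>; the product is empty for \<open>n = -1\<close>.\<close>

definition odd_dfact :: "int \<Rightarrow> real" where
  "odd_dfact n = (\<Prod>m = 1..(n + 1) div 2. real_of_int (2 * m - 1))"

text \<open>
  The natural subtraction \<open>card \<pi> - i\<close> does not truncate: every element of
  \<open>singletons_of k (\<sigma> \<squnion> \<tau>)\<close> is a singleton block of each \<open>\<pi> \<le> \<sigma> \<sqinter> \<tau>\<close>, so \<open>i \<le> d \<le> card \<pi>\<close>.
\<close>

definition centered_Wg :: "nat \<Rightarrow> nat set set \<Rightarrow> nat set set \<Rightarrow> nat \<Rightarrow> real" where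
  "centered_Wg k \<sigma> \<tau> N =
     (let P = set_partitions k; d = card (singletons_of k (\<sigma> \<squnion>\<^bsub>P\<^esub> \<tau>)) in
      \<Sum>i = 0..d. real (d choose i) * (-1) ^ i *
        (\<Sum>\<pi> \<in> {\<pi> \<in> carrier P. \<pi> \<sqsubseteq>\<^bsub>P\<^esub> \<sigma> \<sqinter>\<^bsub>P\<^esub> \<tau>}.
           moebius \<pi> \<sigma> * moebius \<pi> \<tau> * real N powi (- int i) *
           (1 / falling_fact (real N) (card \<pi> - i))))"

definition a_tilde :: "nat \<Rightarrow> nat \<Rightarrow> real" where
  "a_tilde k N = (let k' = k div 2 in
     if even k then odd_dfact (2 * int k' - 1) * real N powi (- 3 * int k')
     else 4 * real k' / 3 * odd_dfact (2 * int k' + 1) * real N powi (- 3 * int k' - 2))"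

text \<open>
  \<open>f(N) = g(N) (1 + O(1/N))\<close> as \<open>N \<rightarrow> \<infinity>\<close>, for functions defined on \<open>N \<ge> k\<close>. Where \<open>g\<close> vanishes
  identically, this says that \<open>f\<close> does.
\<close>

definition rel_asymp_from :: "nat \<Rightarrow> (nat \<Rightarrow> real) \<Rightarrow> (nat \<Rightarrow> real) \<Rightarrow> bool" where
  "rel_asymp_from k f g \<longleftrightarrow>
     (\<exists>\<epsilon> :: nat \<Rightarrow> real. \<epsilon> \<in> O(\<lambda>N. 1 / real N) \<and> (\<forall>N\<ge>k. f N = g N * (1 + \<epsilon> N)))"

end

theory Submission
  imports Defs "HOL-Real_Asymp.Real_Asymp"
begin

text \<open>
  Write \<open>u\<^sub>N(m) = N\<^sup>m / (N)\<^sub>m\<close>. After exchanging the two sums, the sum over \<open>i\<close> attached to a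
  partition \<open>\<pi>\<close> with \<open>n\<close> blocks is \<open>N\<close> to the power \<open>-n\<close> times the backward difference
  \<open>T\<^sub>d(n)\<close> of order \<open>d\<close> of \<open>u\<^sub>N\<close> at \<open>n\<close> (\<open>centered_Wg_as_differences\<close>). So centering is repeated
  differencing, and the theorem asks how much cancellation each difference brings.

  Since \<open>u\<^sub>N(m) - u\<^sub>N(m - 1) = ((m - 1) / N) u\<^sub>N(m)\<close>, one difference amounts to a multiplication by a
  linear function of \<open>m\<close> and a division by \<open>N\<close>. The Leibniz rule for the linear factor then gives
  the recurrence (\<open>bdiff_falling_ratio_Suc\<close>)
  \<open>T\<^bsub>d+1\<^esub>(n) = ((n - 1) T\<^sub>d(n) + d T\<^bsub>d-1\<^esub>(n - 1)) / N\<close>.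
  It resembles the recurrence of the Hermite polynomials: the second summand loses one power of
  \<open>N\<close> for two differences. Hence \<open>T\<^sub>d\<close> has order \<open>N\<close> to the power \<open>-\<lceil>d/2\<rceil>\<close>. For even \<open>d\<close> only the
  second summand counts and the coefficients multiply up to \<open>(d - 1)!!\<close>; for odd \<open>d\<close> both
  summands have the same order, which produces the factor \<open>n - d/3 - 2/3\<close>
  (\<open>bdiff_falling_ratio_asymp\<close>).

  The order of the term of \<open>\<pi>\<close> is therefore \<open>N\<close> to the power \<open>-(n + \<lceil>d/2\<rceil>)\<close>. A proper refinement
  of \<open>\<rho>\<close>, the meet of \<open>\<sigma>\<close> and \<open>\<tau>\<close>, has more blocks than \<open>\<rho>\<close>, so the single term \<open>\<pi> = \<rho>\<close>
  dominates (\<open>rate_tendsto_centered_Wg\<close>). The limit coefficient turns into a relative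
  error because it is nonzero: the singletons of the join are blocks of \<open>\<rho>\<close>, whence \<open>d \<le> n\<close> for
  the number \<open>n\<close> of blocks of \<open>\<rho>\<close>, and then \<open>n - d/3 - 2/3\<close> vanishes only for \<open>d = n = 1\<close>. That occurs only if \<open>k = 1\<close>, where
  \<open>T\<^sub>1(1) = 0\<close> exactly. The case \<open>d = k\<close> is the case \<open>n = d\<close> of the same formula.
\<close>

section \<open>Limits with error of order 1/N\<close>

definition rate_tendsto :: "(nat \<Rightarrow> real) \<Rightarrow> real \<Rightarrow> bool" where
  "rate_tendsto f c \<longleftrightarrow> (\<lambda>N. f N - c) \<in> O(\<lambda>N. 1 / real N)"

lemma rate_tendsto_const: "rate_tendsto (\<lambda>_. c) c"
  by (simp add: rate_tendsto_def)

lemma rate_tendsto_add: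
  assumes "rate_tendsto f a" "rate_tendsto g b"
  shows "rate_tendsto (\<lambda>N. f N + g N) (a + b)"
proof -
  have "(\<lambda>N. (f N - a) + (g N - b)) \<in> O(\<lambda>N. 1 / real N)"
    using assms unfolding rate_tendsto_def by (rule sum_in_bigo)
  then show ?thesis
    by (simp add: rate_tendsto_def algebra_simps)
qed

lemma rate_tendsto_cmult:
  assumes "rate_tendsto f a"
  shows "rate_tendsto (\<lambda>N. c * f N) (c * a)"
proof -
  have "(\<lambda>N. c * (f N - a)) \<in> O(\<lambda>N. 1 / real N)"
    using assms by (cases "c = 0") (simp_all add: rate_tendsto_def)
  then show ?thesis
    by (simp add: rate_tendsto_def algebra_simps)
qed

lemma rate_tendsto_bounded:
  assumes "rate_tendsto f a"
  shows "f \<in> O(\<lambda>_. 1)"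
proof -
  have "(\<lambda>N. 1 / real N) \<in> O(\<lambda>_. 1 :: real)"
    by (rule bigoI[where c = 1]) (auto intro!: eventually_mono[OF eventually_ge_at_top[of 1]])
  then have "(\<lambda>N. f N - a) \<in> O(\<lambda>_. 1)"
    using assms unfolding rate_tendsto_def by (rule landau_o.big_trans[rotated])
  then have "(\<lambda>N. (f N - a) + a) \<in> O(\<lambda>_. 1)"
    by (rule sum_in_bigo) simp
  then show ?thesis by simp
qed

text \<open>
  A term that carries a spare factor \<open>1/N\<close> disappears from the leading coefficient.
\<close>

lemma rate_tendsto_damped:
  assumes "rate_tendsto f a"
  shows "rate_tendsto (\<lambda>N. 1 / real N * f N) 0"
proof -
  have "(\<lambda>N. 1 / real N * f N) \<in> O(\<lambda>N. 1 / real N * 1)"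
    by (intro landau_o.big.mult rate_tendsto_bounded[OF assms]) simp
  then show ?thesis by (simp add: rate_tendsto_def)
qed

lemma rate_tendsto_sum:
  assumes "\<And>x. x \<in> A \<Longrightarrow> rate_tendsto (f x) (c x)"
  shows "rate_tendsto (\<lambda>N. \<Sum>x\<in>A. f x N) (\<Sum>x\<in>A. c x)"
  using assms
  by (induction A rule: infinite_finite_induct)
     (auto intro: rate_tendsto_const rate_tendsto_add)

lemma rate_tendsto_transfer:
  assumes "eventually (\<lambda>N. f N = g N) at_top" "rate_tendsto g c"
  shows "rate_tendsto f c"
proof -
  have "eventually (\<lambda>N. f N - c = g N - c) at_top"
    using assms(1) by eventually_elim simp
  then show ?thesis
    using assms(2) unfolding rate_tendsto_def by (simp only: landau_o.big.in_cong)
qed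

section \<open>Backward differences\<close>

text \<open>
  The backward difference of order \<open>d\<close> of \<open>v\<close> at \<open>n\<close>, in the expanded form in which it occurs in
  the centered Weingarten function. It is used for \<open>d \<le> n\<close>, where the subtraction does not truncate.
\<close>

definition bdiff :: "nat \<Rightarrow> (nat \<Rightarrow> real) \<Rightarrow> nat \<Rightarrow> real" where
  "bdiff d v n = (\<Sum>i\<le>d. real (d choose i) * (-1) ^ i * v (n - i))"

lemma bdiff_0 [simp]: "bdiff 0 v n = v n"
  by (simp add: bdiff_def)

lemma bdiff_Suc: "bdiff (Suc d) v n = bdiff d (\<lambda>m. v m - v (m - 1)) n"
proof -
  have "bdiff (Suc d) v n = v n + (\<Sum>i\<le>d. real (Suc d choose Suc i) * (-1) ^ Suc i * v (n - Suc i))"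
    unfolding bdiff_def by (subst sum.atMost_Suc_shift) simp
  also have "\<dots> = v n + (\<Sum>i\<le>d. real (d choose Suc i) * (-1) ^ Suc i * v (n - Suc i))
      - (\<Sum>i\<le>d. real (d choose i) * (-1) ^ i * v (n - Suc i))"
    by (simp add: sum.distrib[symmetric] sum_subtractf[symmetric] algebra_simps)
  also have "v n + (\<Sum>i\<le>d. real (d choose Suc i) * (-1) ^ Suc i * v (n - Suc i))
      = (\<Sum>i\<le>Suc d. real (d choose i) * (-1) ^ i * v (n - i))"
    by (subst sum.atMost_Suc_shift) simp
  also have "\<dots> = (\<Sum>i\<le>d. real (d choose i) * (-1) ^ i * v (n - i))"
    by simp
  finally show ?thesis
    by (simp add: bdiff_def sum_subtractf algebra_simps)
qed

text \<open>
  The Leibniz rule for a linear factor: its first difference is constant and the higher ones vanish,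
  so that two summands remain. Concretely, \<open>m - 1\<close> at \<open>m = n - i\<close> is \<open>(n - 1) - i\<close>, and the \<open>i\<close> is
  absorbed into the binomial coefficient.
\<close>

lemma bdiff_linear_factor:
  assumes "d \<le> n"
  shows "bdiff d (\<lambda>m. (real m - 1) * v m) n
    = (real n - 1) * bdiff d v n + real d * bdiff (d - 1) v (n - 1)"
proof (cases d)
  case 0
  then show ?thesis by simp
next
  case (Suc e)
  have "(\<Sum>i\<le>d. real i * (real (d choose i) * (-1) ^ i * v (n - i)))
      = (\<Sum>i\<le>e. real (Suc i) * (real (d choose Suc i) * (-1) ^ Suc i * v (n - Suc i)))"
    unfolding Suc by (subst sum.atMost_Suc_shift) simp
  also have "\<dots> = (\<Sum>i\<le>e. - real d * (real (e choose i) * (-1) ^ i * v (n - 1 - i)))"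
  proof (rule sum.cong[OF refl])
    fix i
    have "real (Suc i) * real (d choose Suc i) = real d * real (e choose i)"
      unfolding Suc using Suc_times_binomial_eq[of e i] by (metis mult.commute of_nat_mult)
    then have "real (Suc i) * real (d choose Suc i) * ((-1) ^ Suc i * v (n - Suc i))
        = real d * real (e choose i) * ((-1) ^ Suc i * v (n - Suc i))"
      by (rule arg_cong)
    then show "real (Suc i) * (real (d choose Suc i) * (-1) ^ Suc i * v (n - Suc i))
        = - real d * (real (e choose i) * (-1) ^ i * v (n - 1 - i))"
      by (simp add: mult.assoc)
  qed
  also have "\<dots> = - real d * bdiff e v (n - 1)"
    by (simp only: bdiff_def sum_distrib_left)
  finally have shifted: "(\<Sum>i\<le>d. real i * (real (d choose i) * (-1) ^ i * v (n - i)))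
      = - real d * bdiff e v (n - 1)" .
  have "bdiff d (\<lambda>m. (real m - 1) * v m) n
      = (\<Sum>i\<le>d. (real n - 1) * (real (d choose i) * (-1) ^ i * v (n - i))
              - real i * (real (d choose i) * (-1) ^ i * v (n - i)))"
    unfolding bdiff_def by (rule sum.cong) (use assms in \<open>simp_all add: of_nat_diff algebra_simps\<close>)
  also have "\<dots> = (real n - 1) * bdiff d v n
      - (\<Sum>i\<le>d. real i * (real (d choose i) * (-1) ^ i * v (n - i)))"
    unfolding bdiff_def by (simp only: sum_subtractf sum_distrib_left)
  finally show ?thesis
    by (simp only: shifted) (simp add: Suc algebra_simps)
qed

section \<open>Differences of the powers over the falling factorials\<close>

definition falling_ratio :: "nat \<Rightarrow> nat \<Rightarrow> real" where
  "falling_ratio N m = real N ^ m / falling_fact (real N) m"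

lemma falling_fact_pos: "m \<le> N \<Longrightarrow> falling_fact (real N) m > 0"
  unfolding falling_fact_def by (rule prod_pos) auto

lemma falling_ratio_step:
  assumes "1 \<le> m" "m \<le> N"
  shows "falling_ratio N m - falling_ratio N (m - 1) = (real m - 1) / real N * falling_ratio N m"
proof -
  obtain j where m: "m = Suc j"
    using assms(1) by (cases m) auto
  have "falling_fact (real N) j > 0" "real N - real j > 0"
    using assms m by (auto intro: falling_fact_pos)
  moreover have "falling_fact (real N) m = falling_fact (real N) j * (real N - real j)"
    by (simp add: falling_fact_def m mult.commute)
  ultimately show ?thesis
    using assms by (simp add: falling_ratio_def m divide_simps) (simp add: algebra_simps)
qed

text \<open>
  One of the \<open>d + 1\<close> differences becomes the factor \<open>(m - 1) / N\<close>, through which the other \<open>d\<close> pass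
  by the Leibniz rule. For \<open>d = 0\<close> the truncated order \<open>d - 1\<close> has the coefficient \<open>0\<close>.
\<close>

lemma bdiff_falling_ratio_Suc:
  assumes "Suc d \<le> n" "n \<le> N"
  shows "bdiff (Suc d) (falling_ratio N) n
    = 1 / real N * ((real n - 1) * bdiff d (falling_ratio N) n
        + real d * bdiff (d - 1) (falling_ratio N) (n - 1))"
proof -
  have "bdiff (Suc d) (falling_ratio N) n
      = 1 / real N * bdiff d (\<lambda>m. (real m - 1) * falling_ratio N m) n"
    unfolding bdiff_Suc unfolding bdiff_def sum_distrib_left
  proof (rule sum.cong[OF refl])
    fix i assume "i \<in> {..d}"
    then have "falling_ratio N (n - i) - falling_ratio N (n - i - 1)
        = (real (n - i) - 1) / real N * falling_ratio N (n - i)"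
      using assms by (intro falling_ratio_step) auto
    then show "real (d choose i) * (-1) ^ i * (falling_ratio N (n - i) - falling_ratio N (n - i - 1))
        = 1 / real N * (real (d choose i) * (-1) ^ i * ((real (n - i) - 1) * falling_ratio N (n - i)))"
      by simp
  qed
  then show ?thesis
    using assms by (simp add: bdiff_linear_factor)
qed

lemma rate_tendsto_falling_ratio: "rate_tendsto (\<lambda>N. falling_ratio N n) 1"
proof (induction n)
  case 0
  then show ?case by (simp add: falling_ratio_def falling_fact_def rate_tendsto_const)
next
  case (Suc n)
  have "(\<lambda>N. real n / (real N - real n)) \<in> O(\<lambda>N. 1 / real N)"
    by real_asymp
  then have "(\<lambda>N. real n / (real N - real n) * falling_ratio N n) \<in> O(\<lambda>N. 1 / real N * 1)"
    by (intro landau_o.big.mult rate_tendsto_bounded[OF Suc])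
  then have "rate_tendsto (\<lambda>N. real n / (real N - real n) * falling_ratio N n) 0"
    by (simp add: rate_tendsto_def)
  with Suc have "rate_tendsto (\<lambda>N. falling_ratio N n + real n / (real N - real n) * falling_ratio N n) (1 + 0)"
    by (rule rate_tendsto_add)
  moreover have "eventually (\<lambda>N. falling_ratio N (Suc n)
      = falling_ratio N n + real n / (real N - real n) * falling_ratio N n) at_top"
    using eventually_gt_at_top[of n]
  proof eventually_elim
    case (elim N)
    have "falling_fact (real N) (Suc n) = falling_fact (real N) n * (real N - real n)"
      by (simp add: falling_fact_def)
    with elim falling_fact_pos[of n N] show ?case
      by (simp add: falling_ratio_def divide_simps) (simp add: algebra_simps)
  qed
  ultimately have "rate_tendsto (\<lambda>N. falling_ratio N (Suc n)) (1 + 0)"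
    by (rule rate_tendsto_transfer[rotated])
  then show ?case by simp
qed

text \<open>
  The coefficient of \<open>N\<close> to the power \<open>-\<lceil>d/2\<rceil>\<close> in the difference of order \<open>d\<close> at \<open>n\<close>. It may be
  zero for odd \<open>d\<close>. For \<open>n = d = 2k' + 1\<close> it is \<open>(4k'/3) (2k' + 1)!!\<close>, as in the case \<open>d = k\<close> of the
  theorem.
\<close>

definition diff_coeff :: "nat \<Rightarrow> nat \<Rightarrow> real" where
  "diff_coeff d n = (if even d then odd_dfact (int d - 1)
     else (real n - real d / 3 - 2 / 3) * odd_dfact (int d))"

lemma odd_dfact_step: "odd_dfact (2 * int m + 1) = (2 * real m + 1) * odd_dfact (2 * int m - 1)"
proof -
  have "{1..int m + 1} = insert (int m + 1) {1..int m}" by auto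
  moreover have "(2 * int m + 1 + 1) div 2 = int m + 1" "(2 * int m - 1 + 1) div 2 = int m" by auto
  ultimately show ?thesis
    unfolding odd_dfact_def by (simp add: algebra_simps)
qed

lemma odd_dfact_pos: "odd_dfact n > 0"
  unfolding odd_dfact_def by (rule prod_pos) auto

text \<open>
  The recurrence for the leading coefficients. From an odd to an even order the term
  with the factor \<open>n - 1\<close> is too small to contribute, so the coefficient does not depend on \<open>n\<close>;
  the free variable \<open>n'\<close> expresses this.
\<close>

lemma diff_coeff_even_Suc:
  "diff_coeff (Suc (Suc (2 * m))) n = (2 * real m + 1) * diff_coeff (2 * m) n'"
  using odd_dfact_step[of m] by (simp add: diff_coeff_def algebra_simps)

lemma diff_coeff_odd_Suc:
  assumes "1 \<le> n"
  shows "diff_coeff (Suc (2 * m)) n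
    = (real n - 1) * diff_coeff (2 * m) n + 2 * real m * diff_coeff (2 * m - 1) (n - 1)"
proof (cases m)
  case 0
  then show ?thesis using odd_dfact_step[of 0] by (simp add: diff_coeff_def)
next
  case (Suc j)
  define w where "w = odd_dfact (2 * int m - 1)"
  have "diff_coeff (Suc (2 * m)) n = (real n - 1 - 2 * real m / 3) * odd_dfact (2 * int m + 1)"
    by (simp add: diff_coeff_def field_simps)
  then have "diff_coeff (Suc (2 * m)) n = (real n - 1 - 2 * real m / 3) * ((2 * real m + 1) * w)"
    by (simp only: odd_dfact_step w_def)
  moreover have "diff_coeff (2 * m - 1) (n - 1) = (real n - 1 - (2 * real m - 1) / 3 - 2 / 3) * w"
  proof -
    have "odd (2 * m - 1)" "int (2 * m - 1) = 2 * int m - 1" "real (2 * m - 1) = 2 * real m - 1"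
      using Suc by (auto simp: of_nat_diff)
    then show ?thesis
      using assms by (simp add: diff_coeff_def of_nat_diff w_def)
  qed
  moreover have "diff_coeff (2 * m) n = w"
    by (simp add: diff_coeff_def w_def)
  ultimately show ?thesis
    by (simp only:) (simp add: field_simps)
qed

text \<open>
  The exponent \<open>(d + 1) div 2\<close> is \<open>\<lceil>d/2\<rceil>\<close>. It grows by one from the even order \<open>2m\<close> to \<open>2m + 1\<close>,
  so there both terms of the recurrence survive the division by \<open>N\<close>. It stays the same from
  \<open>2m + 1\<close> to \<open>2m + 2\<close>, so there the first term is damped by \<open>1/N\<close>.
\<close>

lemma bdiff_falling_ratio_asymp:
  "d \<le> n \<Longrightarrow> rate_tendsto (\<lambda>N. real N ^ ((d + 1) div 2) * bdiff d (falling_ratio N) n) (diff_coeff d n)"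
proof (induction d arbitrary: n rule: less_induct)
  case (less d)
  define F where "F e m N = real N ^ ((e + 1) div 2) * bdiff e (falling_ratio N) m" for e m N
  have IH: "rate_tendsto (F e m) (diff_coeff e m)" if "e < d" "e \<le> m" for e m
    using less.IH[OF that] by (simp add: F_def[abs_def])
  have N: "eventually (\<lambda>N. max n 1 \<le> N) at_top"
    by (rule eventually_ge_at_top)
  consider "d = 0" | m where "d = Suc (2 * m)" | m where "d = Suc (Suc (2 * m))"
    by (metis evenE oddE Suc_eq_plus1 not0_implies_Suc even_Suc)
  then have "rate_tendsto (F d n) (diff_coeff d n)"
  proof cases
    case 1
    then show ?thesis
      using rate_tendsto_falling_ratio[of n]
      by (simp add: F_def[abs_def] diff_coeff_def odd_dfact_def)
  next
    case (2 m)
    have lower: "rate_tendsto (\<lambda>N. 2 * real m * F (2 * m - 1) (n - 1) N) (2 * real m * diff_coeff (2 * m - 1) (n - 1))"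
    proof (cases "m = 0")
      case True
      then show ?thesis by (simp add: rate_tendsto_const)
    next
      case False
      then show ?thesis using 2 less.prems by (intro rate_tendsto_cmult IH) auto
    qed
    have "rate_tendsto (\<lambda>N. (real n - 1) * F (2 * m) n N + 2 * real m * F (2 * m - 1) (n - 1) N)
        ((real n - 1) * diff_coeff (2 * m) n + 2 * real m * diff_coeff (2 * m - 1) (n - 1))"
      using 2 less.prems by (intro rate_tendsto_add lower rate_tendsto_cmult IH) auto
    moreover have "eventually (\<lambda>N. F d n N = (real n - 1) * F (2 * m) n N + 2 * real m * F (2 * m - 1) (n - 1) N) at_top"
      using N
    proof eventually_elim
      case (elim N)
      have "(2 * m - 1 + 1) div 2 = m" "(2 * m + 1) div 2 = m" "(d + 1) div 2 = Suc m"
        using 2 by auto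
      then show ?case
        using elim 2 less.prems
        unfolding F_def by (simp add: bdiff_falling_ratio_Suc field_simps)
    qed
    ultimately have "rate_tendsto (F d n)
        ((real n - 1) * diff_coeff (2 * m) n + 2 * real m * diff_coeff (2 * m - 1) (n - 1))"
      by (rule rate_tendsto_transfer[rotated])
    then show ?thesis
      using 2 less.prems by (simp add: diff_coeff_odd_Suc)
  next
    case (3 m)
    have "rate_tendsto (\<lambda>N. (real n - 1) * (1 / real N * F (Suc (2 * m)) n N) + (2 * real m + 1) * F (2 * m) (n - 1) N)
        ((real n - 1) * 0 + (2 * real m + 1) * diff_coeff (2 * m) (n - 1))"
      using 3 less.prems by (intro rate_tendsto_add rate_tendsto_cmult rate_tendsto_damped[OF IH] IH) auto
    moreover have "eventually (\<lambda>N. F d n N = (real n - 1) * (1 / real N * F (Suc (2 * m)) n N) + (2 * real m + 1) * F (2 * m) (n - 1) N) at_top"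
      using N
    proof eventually_elim
      case (elim N)
      have "(Suc (2 * m) + 1) div 2 = Suc m" "(2 * m + 1) div 2 = m" "(d + 1) div 2 = Suc m"
        using 3 by auto
      then show ?case
        using elim 3 less.prems
        unfolding F_def by (simp add: bdiff_falling_ratio_Suc field_simps)
    qed
    ultimately have "rate_tendsto (F d n)
        ((real n - 1) * 0 + (2 * real m + 1) * diff_coeff (2 * m) (n - 1))"
      by (rule rate_tendsto_transfer[rotated])
    then show ?thesis
      using 3 by (simp add: diff_coeff_even_Suc[of m n "n - 1"])
  qed
  then show ?case by (simp add: F_def[abs_def])
qed

section \<open>Block counts and singletons under refinement\<close>

text \<open>
  The block counts below are compared through an injection of the coarse partition into the fine
  one: every coarse block contains a fine one, and distinct coarse blocks are disjoint.
\<close>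

lemma refines_inj_choice:
  assumes "refines A P Q"
  obtains g where "inj_on g Q" "\<And>B. B \<in> Q \<Longrightarrow> g B \<in> P \<and> g B \<subseteq> B"
proof -
  have PQ: "partition_on A P" "partition_on A Q"
    using assms by (auto simp: refines_def)
  have "\<exists>C\<in>P. C \<subseteq> B" if B: "B \<in> Q" for B
  proof -
    have "B \<noteq> {}"
      using partition_onD3[OF PQ(2)] B by auto
    then obtain x where "x \<in> B"
      by blast
    then have "x \<in> \<Union>P"
      using PQ B unfolding partition_on_def by blast
    then obtain C where C: "C \<in> P" "x \<in> C" by blast
    then obtain B' where B': "B' \<in> Q" "C \<subseteq> B'"
      using assms by (auto simp: refines_def)
    then have "B' = B"
      using PQ(2) B \<open>x \<in> B\<close> C unfolding partition_on_def disjoint_def by blast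
    with C B' show ?thesis by blast
  qed
  then obtain g where g: "\<And>B. B \<in> Q \<Longrightarrow> g B \<in> P \<and> g B \<subseteq> B"
    by metis
  have "inj_on g Q"
  proof (rule inj_onI)
    fix B B' assume B: "B \<in> Q" "B' \<in> Q" "g B = g B'"
    then have "g B \<subseteq> B" "g B \<subseteq> B'"
      using g[OF B(1)] g[OF B(2)] B(3) by simp_all
    moreover have "g B \<noteq> {}"
      using g[OF B(1)] partition_onD3[OF PQ(1)] by auto
    ultimately have "B \<inter> B' \<noteq> {}"
      by blast
    then show "B = B'"
      using disjointD[OF partition_onD2[OF PQ(2)] B(1,2)] by blast
  qed
  with g show ?thesis using that by blast
qed

lemma refines_card_mono:
  assumes "finite A" "refines A P Q"
  shows "card Q \<le> card P"
proof -
  obtain g where "inj_on g Q" "g ` Q \<subseteq> P"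
    using refines_inj_choice[OF assms(2)] by (metis image_subsetI)
  moreover have "finite P"
    using assms finite_elements by (auto simp: refines_def)
  ultimately show ?thesis by (rule card_inj_on_le)
qed

text \<open>
  With equal counts the injection is onto, so each coarse block contains exactly one fine block,
  and it must be filled by it.
\<close>

lemma refines_card_eq:
  assumes "finite A" "refines A P Q" "card P = card Q"
  shows "P = Q"
proof -
  obtain g where g: "inj_on g Q" "\<And>B. B \<in> Q \<Longrightarrow> g B \<in> P \<and> g B \<subseteq> B"
    using refines_inj_choice[OF assms(2)] by metis
  have PQ: "partition_on A P" "partition_on A Q"
    using assms by (auto simp: refines_def)
  have "g ` Q = P"
    using g assms(3) finite_elements[OF assms(1) PQ(1)]
    by (intro card_subset_eq) (auto simp: card_image)
  have "g B = B" if B: "B \<in> Q" for B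
  proof
    show "B \<subseteq> g B"
    proof
      fix x assume x: "x \<in> B"
      then have "x \<in> \<Union>P"
        using PQ B unfolding partition_on_def by blast
      then obtain B' where B': "B' \<in> Q" "x \<in> g B'"
        using \<open>g ` Q = P\<close> by blast
      then have "B' = B"
        using PQ(2) B x g(2) unfolding partition_on_def disjoint_def by blast
      with B' show "x \<in> g B" by simp
    qed
  qed (use g B in blast)
  then show ?thesis
    using \<open>g ` Q = P\<close> by simp
qed

lemma refines_singleton_block:
  assumes "refines A P Q" "{x} \<in> Q"
  shows "{x} \<in> P"
proof -
  obtain g where "g {x} \<in> P" "g {x} \<subseteq> {x}"
    using refines_inj_choice[OF assms(1)] assms(2) by metis
  moreover have "{} \<notin> P"
    using assms(1) by (auto simp: refines_def partition_on_def)
  ultimately show ?thesis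
    by (metis subset_singletonD)
qed

lemma card_singletons_of_le:
  assumes "refines {1..k} P Q"
  shows "card (singletons_of k Q) \<le> card P"
proof (rule card_inj_on_le)
  show "inj_on (\<lambda>j. {j}) (singletons_of k Q)"
    by simp
  show "(\<lambda>j. {j}) ` singletons_of k Q \<subseteq> P"
    using refines_singleton_block[OF assms] by (auto simp: singletons_of_def)
  show "finite P"
    using assms finite_elements[of "{1..k}"] by (auto simp: refines_def)
qed

text \<open>
  The singletons of \<open>Q\<close> are blocks of \<open>P\<close>, and a point outside of them lies in one more block.
\<close>

lemma card_singletons_of_less:
  assumes "refines {1..k} P Q" "card (singletons_of k Q) \<noteq> k"
  shows "card (singletons_of k Q) < card P"
proof -
  have P: "partition_on {1..k} P"
    using assms by (auto simp: refines_def)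
  have "singletons_of k Q \<subseteq> {1..k}"
    by (auto simp: singletons_of_def)
  moreover have "singletons_of k Q \<noteq> {1..k}"
    using assms(2) by fastforce
  ultimately obtain x where x: "x \<in> {1..k}" "x \<notin> singletons_of k Q"
    by blast
  then obtain B where B: "B \<in> P" "x \<in> B"
    using P unfolding partition_on_def by blast
  have "(\<lambda>j. {j}) ` singletons_of k Q \<subseteq> P - {B}"
    using refines_singleton_block[OF assms(1)] B x by (auto simp: singletons_of_def)
  moreover have fin: "finite P"
    using P finite_elements[of "{1..k}"] by auto
  ultimately have "card (singletons_of k Q) \<le> card (P - {B})"
    by (intro card_inj_on_le[of "\<lambda>j. {j}"]) auto
  also have "\<dots> < card P"
    using B fin by (intro psubset_card_mono) auto
  finally show ?thesis .
qed

lemma singletons_refine: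
  assumes "partition_on A P"
  shows "refines A ((\<lambda>x. {x}) ` A) P"
  unfolding refines_def
  using assms partition_on_singletons[of A] partition_onD1[OF assms] by auto

lemma card_partition_le:
  assumes "finite A" "partition_on A P"
  shows "card P \<le> card A"
proof -
  have "card P \<le> card ((\<lambda>x. {x}) ` A)"
    using assms(1) singletons_refine[OF assms(2)] by (rule refines_card_mono)
  then show ?thesis by (simp add: card_image)
qed

lemma refines_zero_partition:
  assumes "refines {1..k} P (zero_partition k)"
  shows "P = zero_partition k"
proof -
  have "partition_on {1..k} P"
    using assms by (simp add: refines_def)
  then have "refines {1..k} (zero_partition k) P"
    unfolding zero_partition_def by (rule singletons_refine)
  with assms show ?thesis by (rule refines_asym)
qed

lemma singletons_of_eq_all_iff:
  assumes "partition_on {1..k} P"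
  shows "card (singletons_of k P) = k \<longleftrightarrow> P = zero_partition k"
proof
  assume "card (singletons_of k P) = k"
  then have all: "singletons_of k P = {1..k}"
    by (intro card_subset_eq) (auto simp: singletons_of_def)
  have singleton: "{x} \<in> P" if "x \<in> {1..k}" for x
  proof -
    have "x \<in> singletons_of k P"
      using that by (simp only: all)
    then show ?thesis by (simp add: singletons_of_def)
  qed
  have "C \<in> zero_partition k" if C: "C \<in> P" for C
  proof -
    have "C \<noteq> {}" "C \<subseteq> {1..k}"
      using partition_onD1[OF assms] partition_onD3[OF assms] C by auto
    then obtain x where x: "x \<in> C" "x \<in> {1..k}"
      by blast
    then have "C = {x}"
      using disjointD[OF partition_onD2[OF assms] C singleton[OF x(2)]] by auto
    with x show ?thesis by (simp add: zero_partition_def)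
  qed
  then have "refines {1..k} P (zero_partition k)"
    unfolding refines_def using assms partition_on_singletons[of "{1..k}"]
    by (auto simp: zero_partition_def)
  then show "P = zero_partition k"
    by (rule refines_zero_partition)
next
  assume "P = zero_partition k"
  then have "singletons_of k P = {1..k}"
    by (auto simp: zero_partition_def singletons_of_def)
  then show "card (singletons_of k P) = k" by simp
qed

lemma moebius_nonzero: "moebius P Q \<noteq> 0"
  unfolding moebius_def Let_def
  by (cases "finite Q") (auto simp: prod_zero_iff)

lemma moebius_zero_partition: "moebius (zero_partition k) (zero_partition k) = 1"
  unfolding moebius_def
proof (rule prod.neutral, safe)
  fix B assume "B \<in> zero_partition k"
  then have "{C \<in> zero_partition k. C \<subseteq> B} = {B}"
    by (auto simp: zero_partition_def)
  then show "(let l = card {C \<in> zero_partition k. C \<subseteq> B} in (- 1) ^ (l - 1) * fact (l - 1)) = (1::real)"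
    by simp
qed

section \<open>The centered Weingarten function\<close>

text \<open>
  For odd \<open>d\<close> the factor \<open>n - d/3 - 2/3\<close> is at least \<open>2(d - 1)/3\<close>; for \<open>d = 1\<close> it is \<open>n - 1\<close>.
\<close>

lemma diff_coeff_nonzero:
  assumes "d \<le> n" "n \<noteq> 1 \<or> d \<noteq> 1"
  shows "diff_coeff d n \<noteq> 0"
proof (cases "even d")
  case True
  then show ?thesis using odd_dfact_pos[of "int d - 1"] by (simp add: diff_coeff_def)
next
  case False
  then have "1 \<le> d" by (cases d) auto
  with assms have "real n - real d / 3 - 2 / 3 > 0"
    by (cases "d = 1") auto
  with False show ?thesis
    using odd_dfact_pos[of "int d"] by (simp add: diff_coeff_def)
qed

text \<open>
  The powers \<open>N\<^bsup>-i\<^esup>\<close> are exactly what turns \<open>1 / (N)\<^bsub>n-i\<^esub>\<close> into \<open>N\<^bsup>n-i\<^esup> / (N)\<^bsub>n-i\<^esub>\<close> up to the common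
  factor \<open>N\<^bsup>-n\<^esup>\<close>, where \<open>n\<close> is the number of blocks. The bound \<open>d \<le> n\<close> keeps \<open>n - i\<close> from truncating.
\<close>

lemma centered_Wg_as_differences:
  fixes k d N :: nat and \<sigma> \<tau> \<rho> :: "nat set set"
  assumes "d = card (singletons_of k (\<sigma> \<squnion>\<^bsub>set_partitions k\<^esub> \<tau>))"
    and "\<rho> = \<sigma> \<sqinter>\<^bsub>set_partitions k\<^esub> \<tau>"
    and "N \<ge> 1" and "\<And>\<pi>. refines {1..k} \<pi> \<rho> \<Longrightarrow> d \<le> card \<pi>"
  shows "centered_Wg k \<sigma> \<tau> N = (\<Sum>\<pi> | refines {1..k} \<pi> \<rho>.
    moebius \<pi> \<sigma> * moebius \<pi> \<tau> / real N ^ card \<pi> * bdiff d (falling_ratio N) (card \<pi>))"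
proof -
  have below: "{\<pi> \<in> carrier (set_partitions k). \<pi> \<sqsubseteq>\<^bsub>set_partitions k\<^esub> \<rho>} = {\<pi>. refines {1..k} \<pi> \<rho>}"
    by (auto simp: set_partitions_def refines_def)
  have "centered_Wg k \<sigma> \<tau> N = (\<Sum>i\<le>d. \<Sum>\<pi> | refines {1..k} \<pi> \<rho>.
      real (d choose i) * (-1) ^ i * (moebius \<pi> \<sigma> * moebius \<pi> \<tau> * real N powi (- int i) *
        (1 / falling_fact (real N) (card \<pi> - i))))"
    unfolding centered_Wg_def Let_def assms(1,2)[symmetric] below
    by (simp add: sum_distrib_left atMost_atLeast0)
  also have "\<dots> = (\<Sum>\<pi> | refines {1..k} \<pi> \<rho>. \<Sum>i\<le>d.
      real (d choose i) * (-1) ^ i * (moebius \<pi> \<sigma> * moebius \<pi> \<tau> * real N powi (- int i) *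
        (1 / falling_fact (real N) (card \<pi> - i))))"
    by (rule sum.swap)
  also have "\<dots> = (\<Sum>\<pi> | refines {1..k} \<pi> \<rho>.
    moebius \<pi> \<sigma> * moebius \<pi> \<tau> / real N ^ card \<pi> * bdiff d (falling_ratio N) (card \<pi>))"
    unfolding bdiff_def sum_distrib_left
  proof (intro sum.cong refl)
    fix \<pi> i assume "\<pi> \<in> {\<pi>. refines {1..k} \<pi> \<rho>}" "i \<in> {..d}"
    then have "i \<le> card \<pi>"
      using assms(4) by fastforce
    then have "real N ^ card \<pi> = real N ^ i * real N ^ (card \<pi> - i)"
      by (simp flip: power_add)
    then show "real (d choose i) * (-1) ^ i * (moebius \<pi> \<sigma> * moebius \<pi> \<tau> * real N powi (- int i) *
        (1 / falling_fact (real N) (card \<pi> - i)))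
      = moebius \<pi> \<sigma> * moebius \<pi> \<tau> / real N ^ card \<pi> *
        (real (d choose i) * (-1) ^ i * falling_ratio N (card \<pi> - i))"
      using \<open>N \<ge> 1\<close> by (simp add: falling_ratio_def power_int_minus divide_simps)
  qed
  finally show ?thesis .
qed

text \<open>
  The identity with the error term is required for every \<open>N \<ge> k\<close>, not just eventually. As the
  comparison function has no zero there, the error term can be defined as the quotient minus one.
\<close>

lemma rel_asymp_fromI:
  assumes lim: "rate_tendsto (\<lambda>N. real N ^ e * f N) c" and "c \<noteq> 0" and "k \<ge> 1"
    and g: "\<And>N. N \<ge> k \<Longrightarrow> g N = c * real N powi (- int e)"
  shows "rel_asymp_from k f g"
  unfolding rel_asymp_from_def
proof (intro exI conjI allI impI)
  define \<epsilon> where "\<epsilon> N = f N / g N - 1" for N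
  have "rate_tendsto (\<lambda>N. 1 / c * (real N ^ e * f N)) (1 / c * c)"
    using lim by (rule rate_tendsto_cmult)
  then have "(\<lambda>N. 1 / c * (real N ^ e * f N) - 1) \<in> O(\<lambda>N. 1 / real N)"
    using \<open>c \<noteq> 0\<close> by (simp add: rate_tendsto_def)
  moreover have "eventually (\<lambda>N. 1 / c * (real N ^ e * f N) - 1 = \<epsilon> N) at_top"
    using eventually_ge_at_top[of k]
  proof eventually_elim
    case (elim N)
    then show ?case
      using \<open>c \<noteq> 0\<close> \<open>k \<ge> 1\<close> by (simp add: \<epsilon>_def g power_int_minus field_simps)
  qed
  ultimately show "\<epsilon> \<in> O(\<lambda>N. 1 / real N)"
    by (simp add: landau_o.big.in_cong)
  fix N assume "N \<ge> k"
  then have "g N \<noteq> 0"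
    using \<open>c \<noteq> 0\<close> \<open>k \<ge> 1\<close> g by simp
  then show "f N = g N * (1 + \<epsilon> N)"
    by (simp add: \<epsilon>_def)
qed

text \<open>
  Every term is normalized by the order of the term of \<open>\<rho>\<close>. The differences are at most of the
  same order in \<open>N\<close> for all terms, so each block that \<open>\<pi>\<close> has in excess of \<open>\<rho>\<close> costs a factor \<open>1 / N\<close>.
\<close>

lemma rate_tendsto_centered_Wg:
  fixes k d :: nat and \<sigma> \<tau> \<rho> :: "nat set set"
  assumes "d = card (singletons_of k (\<sigma> \<squnion>\<^bsub>set_partitions k\<^esub> \<tau>))"
    and "\<rho> = \<sigma> \<sqinter>\<^bsub>set_partitions k\<^esub> \<tau>"
    and d_le: "\<And>\<pi>. refines {1..k} \<pi> \<rho> \<Longrightarrow> d \<le> card \<pi>"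
    and \<rho>: "partition_on {1..k} \<rho>"
  shows "rate_tendsto (\<lambda>N. real N ^ (card \<rho> + (d + 1) div 2) * centered_Wg k \<sigma> \<tau> N)
    (moebius \<rho> \<sigma> * moebius \<rho> \<tau> * diff_coeff d (card \<rho>))"
proof -
  let ?below = "{\<pi>. refines {1..k} \<pi> \<rho>}"
  define D where "D n N = real N ^ ((d + 1) div 2) * bdiff d (falling_ratio N) n" for n N
  define w where "w \<pi> = moebius \<pi> \<sigma> * moebius \<pi> \<tau>" for \<pi>
  have D: "rate_tendsto (D n) (diff_coeff d n)" if "d \<le> n" for n
    using bdiff_falling_ratio_asymp[OF that] by (simp add: D_def[abs_def])
  have "finite {\<pi>. partition_on {1..k} \<pi>}"
    by (rule finitely_many_partition_on) simp
  then have fin: "finite ?below"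
    by (rule finite_subset[rotated]) (auto simp: refines_def)
  have term_lim: "rate_tendsto (\<lambda>N. w \<pi> * (real N ^ card \<rho> / real N ^ card \<pi> * D (card \<pi>) N))
      (w \<pi> * (if \<pi> = \<rho> then diff_coeff d (card \<rho>) else 0))"
    if \<pi>: "refines {1..k} \<pi> \<rho>" for \<pi>
  proof (rule rate_tendsto_cmult, cases "\<pi> = \<rho>")
    case True
    have "eventually (\<lambda>N. real N ^ card \<rho> / real N ^ card \<pi> * D (card \<pi>) N = D (card \<rho>) N) at_top"
      using eventually_ge_at_top[of 1] by eventually_elim (simp add: True)
    moreover have "rate_tendsto (D (card \<rho>)) (diff_coeff d (card \<rho>))"
      using D d_le[OF \<pi>] True by simp
    ultimately show "rate_tendsto (\<lambda>N. real N ^ card \<rho> / real N ^ card \<pi> * D (card \<pi>) N)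
        (if \<pi> = \<rho> then diff_coeff d (card \<rho>) else 0)"
      unfolding if_P[OF True] by (rule rate_tendsto_transfer)
  next
    case False
    then have "card \<rho> < card \<pi>"
      using refines_card_mono[OF _ \<pi>] refines_card_eq[OF _ \<pi>] by fastforce
    \<comment> \<open>The surplus of \<open>Suc j\<close> blocks leaves at least one spare factor \<open>1 / N\<close>.\<close>
    then obtain j where j: "card \<pi> = Suc (card \<rho> + j)"
      using less_iff_Suc_add by auto
    have "(\<lambda>N. 1 / real N ^ Suc j) \<in> O(\<lambda>N. 1 / real N)"
    proof (rule bigoI[where c = 1])
      show "eventually (\<lambda>N. norm (1 / real N ^ Suc j) \<le> 1 * norm (1 / real N)) at_top"
        using eventually_ge_at_top[of 1]
      proof eventually_elim
        case (elim N)
        then have "real N ^ 1 \<le> real N ^ Suc j"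
          by (intro power_increasing) auto
        then show ?case
          using elim by (simp add: divide_simps)
      qed
    qed
    then have "(\<lambda>N. 1 / real N ^ Suc j * D (card \<pi>) N) \<in> O(\<lambda>N. 1 / real N * 1)"
      by (intro landau_o.big.mult rate_tendsto_bounded[OF D] d_le[OF \<pi>])
    then have "rate_tendsto (\<lambda>N. 1 / real N ^ Suc j * D (card \<pi>) N) 0"
      by (simp add: rate_tendsto_def)
    moreover have "eventually (\<lambda>N. real N ^ card \<rho> / real N ^ card \<pi> * D (card \<pi>) N
        = 1 / real N ^ Suc j * D (card \<pi>) N) at_top"
      using eventually_ge_at_top[of 1] by eventually_elim (simp add: j power_add)
    ultimately show "rate_tendsto (\<lambda>N. real N ^ card \<rho> / real N ^ card \<pi> * D (card \<pi>) N)
        (if \<pi> = \<rho> then diff_coeff d (card \<rho>) else 0)"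
      unfolding if_not_P[OF False] by (rule rate_tendsto_transfer[rotated])
  qed
  have "rate_tendsto (\<lambda>N. \<Sum>\<pi>\<in>?below. w \<pi> * (real N ^ card \<rho> / real N ^ card \<pi> * D (card \<pi>) N))
      (\<Sum>\<pi>\<in>?below. w \<pi> * (if \<pi> = \<rho> then diff_coeff d (card \<rho>) else 0))"
    by (rule rate_tendsto_sum) (use term_lim in simp)
  also have "(\<Sum>\<pi>\<in>?below. w \<pi> * (if \<pi> = \<rho> then diff_coeff d (card \<rho>) else 0))
      = w \<rho> * diff_coeff d (card \<rho>)"
    using fin refines_refl[OF \<rho>] by (subst sum.remove[of _ \<rho>]) (auto intro!: sum.neutral)
  finally have "rate_tendsto (\<lambda>N. \<Sum>\<pi>\<in>?below. w \<pi> * (real N ^ card \<rho> / real N ^ card \<pi> * D (card \<pi>) N))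
      (w \<rho> * diff_coeff d (card \<rho>))" .
  moreover have "eventually (\<lambda>N. real N ^ (card \<rho> + (d + 1) div 2) * centered_Wg k \<sigma> \<tau> N
      = (\<Sum>\<pi>\<in>?below. w \<pi> * (real N ^ card \<rho> / real N ^ card \<pi> * D (card \<pi>) N))) at_top"
    using eventually_ge_at_top[of 1]
  proof eventually_elim
    case (elim N)
    have "centered_Wg k \<sigma> \<tau> N = (\<Sum>\<pi>\<in>?below.
        w \<pi> / real N ^ card \<pi> * bdiff d (falling_ratio N) (card \<pi>))"
      unfolding w_def using assms(1,2) elim d_le by (rule centered_Wg_as_differences)
    then show ?case
      by (simp add: D_def power_add sum_distrib_left mult_ac)
  qed
  ultimately show ?thesis
    unfolding w_def by (rule rate_tendsto_transfer[rotated])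
qed

theorem proposition4p1:
  fixes k d :: nat and P :: "nat set set gorder" and \<sigma> \<tau> \<rho> :: "nat set set"
  assumes "k \<ge> 1"
    and "P = set_partitions k"
    and "\<sigma> \<in> carrier P" and "\<tau> \<in> carrier P"
    and "d = card (singletons_of k (\<sigma> \<squnion>\<^bsub>P\<^esub> \<tau>))"
    and "\<rho> = \<sigma> \<sqinter>\<^bsub>P\<^esub> \<tau>"
  shows "(d = k \<longleftrightarrow> \<sigma> = zero_partition k \<and> \<tau> = zero_partition k) \<and>
    (d = k \<longrightarrow>
      rel_asymp_from k (centered_Wg k \<sigma> \<tau>) (a_tilde k)) \<and>
    (even d \<and> d \<noteq> k \<longrightarrow>
      rel_asymp_from k (centered_Wg k \<sigma> \<tau>)
        (\<lambda>N. moebius \<rho> \<sigma> * moebius \<rho> \<tau> * odd_dfact (int d - 1) *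
             real N powi (- (int (card \<rho>) + int (d div 2))))) \<and>
    (odd d \<and> d \<noteq> k \<longrightarrow>
      rel_asymp_from k (centered_Wg k \<sigma> \<tau>)
        (\<lambda>N. moebius \<rho> \<sigma> * moebius \<rho> \<tau> *
             (real (card \<rho>) - real d / 3 - 2 / 3) * odd_dfact (int d) *
             real N powi (- (int (card \<rho>) + int ((d + 1) div 2)))))"
proof -
  interpret lattice P
    unfolding assms(2) by (rule lattice_set_partitions)
  let ?\<kappa> = "\<sigma> \<squnion>\<^bsub>P\<^esub> \<tau>"
  have carrier: "\<pi> \<in> carrier P \<longleftrightarrow> partition_on {1..k} \<pi>" for \<pi>
    by (simp add: assms(2) set_partitions_def)
  have le: "\<pi> \<sqsubseteq>\<^bsub>P\<^esub> \<pi>' \<longleftrightarrow> refines {1..k} \<pi> \<pi>'" for \<pi> \<pi>'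
    by (simp add: assms(2) set_partitions_def)
  have join: "refines {1..k} \<sigma> ?\<kappa>" "refines {1..k} \<tau> ?\<kappa>" "partition_on {1..k} ?\<kappa>"
    using join_left[OF assms(3,4)] join_right[OF assms(3,4)] join_closed[OF assms(3,4)]
    by (simp_all only: le carrier)
  have \<rho>: "partition_on {1..k} \<rho>" "refines {1..k} \<rho> \<sigma>" "refines {1..k} \<rho> \<tau>"
    using meet_left[OF assms(3,4)] meet_right[OF assms(3,4)] meet_closed[OF assms(3,4)]
    by (simp_all only: le carrier assms(6))
  have \<rho>_join: "refines {1..k} \<rho> ?\<kappa>"
    using \<rho>(2) join(1) by (rule refines_trans)
  have d_le: "d \<le> card \<pi>" if "refines {1..k} \<pi> \<rho>" for \<pi>
    unfolding assms(5) by (rule card_singletons_of_le) (rule refines_trans[OF that \<rho>_join])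
  have d_less: "d < card \<rho>" if "d \<noteq> k"
    using card_singletons_of_less[OF \<rho>_join] that assms(5) by simp
  have zero_iff: "d = k \<longleftrightarrow> \<sigma> = zero_partition k \<and> \<tau> = zero_partition k"
  proof
    assume "d = k"
    then have "?\<kappa> = zero_partition k"
      using singletons_of_eq_all_iff[OF join(3)] assms(5) by simp
    then show "\<sigma> = zero_partition k \<and> \<tau> = zero_partition k"
      using join refines_zero_partition by simp
  next
    assume zero: "\<sigma> = zero_partition k \<and> \<tau> = zero_partition k"
    then have "refines {1..k} ?\<kappa> (zero_partition k)"
      using join_le[of \<sigma> "zero_partition k" \<tau>] assms(3,4) by (simp add: le carrier refines_refl)
    then have "?\<kappa> = zero_partition k"
      by (rule refines_zero_partition)
    then show "d = k"
      using singletons_of_eq_all_iff[OF join(3)] assms(5) by simp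
  qed
  have lim: "rate_tendsto (\<lambda>N. real N ^ (card \<rho> + (d + 1) div 2) * centered_Wg k \<sigma> \<tau> N)
      (moebius \<rho> \<sigma> * moebius \<rho> \<tau> * diff_coeff d (card \<rho>))"
    using assms(2,5,6) d_le \<rho>(1) by (intro rate_tendsto_centered_Wg) auto
  have generic: "rel_asymp_from k (centered_Wg k \<sigma> \<tau>) g"
    if "d \<noteq> 1 \<or> card \<rho> \<noteq> 1"
      "\<And>N. N \<ge> k \<Longrightarrow> g N = moebius \<rho> \<sigma> * moebius \<rho> \<tau> * diff_coeff d (card \<rho>) * real N powi (- (int (card \<rho>) + int ((d + 1) div 2)))" for g
    using lim that(2) assms(1) moebius_nonzero diff_coeff_nonzero[of d "card \<rho>"] that(1) d_le[OF refines_refl[OF \<rho>(1)]]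
    by (intro rel_asymp_fromI) auto
  have top: "rel_asymp_from k (centered_Wg k \<sigma> \<tau>) (a_tilde k)" if "d = k"
  proof -
    have st: "\<sigma> = zero_partition k" "\<tau> = zero_partition k"
      using zero_iff that by auto
    then have r: "\<rho> = zero_partition k"
      using \<rho>(2) refines_zero_partition by simp
    then have card_r: "card \<rho> = k"
      by (simp add: zero_partition_def card_image)
    show ?thesis
    proof (cases "k = 1")
      case False
      show ?thesis
      proof (rule generic)
        show "d \<noteq> 1 \<or> card \<rho> \<noteq> 1" using False that by simp
        fix N
        have "a_tilde k N = diff_coeff k k * real N powi (- (int k + int ((k + 1) div 2)))"
        proof (cases "even k")
          case True
          then obtain m where "k = 2 * m" by (elim evenE)
          then show ?thesis by (simp add: a_tilde_def diff_coeff_def)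
        next
          case False
          then obtain m where m: "k = 2 * m + 1" by (elim oddE)
          have "- (int k + int ((k + 1) div 2)) = - 3 * int m - 2"
            by (simp add: m)
          moreover have "diff_coeff k k = 4 * real m / 3 * odd_dfact (2 * int m + 1)"
            by (simp add: diff_coeff_def m algebra_simps)
          moreover have "a_tilde k N = 4 * real m / 3 * odd_dfact (2 * int m + 1) * real N powi (- 3 * int m - 2)"
            by (simp add: a_tilde_def m)
          ultimately show ?thesis by (simp only:)
        qed
        then show "a_tilde k N = moebius \<rho> \<sigma> * moebius \<rho> \<tau> * diff_coeff d (card \<rho>) * real N powi (- (int (card \<rho>) + int ((d + 1) div 2)))"
          using that by (simp only: card_r) (simp add: st r moebius_zero_partition)
      qed
    next
      case True
      \<comment> \<open>Here the coefficient is zero, so the relation holds only because both sides vanish identically.\<close>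
      have "centered_Wg k \<sigma> \<tau> N = 0" if N: "N \<ge> k" for N
      proof -
        have "bdiff d (falling_ratio N) (card \<pi>) = 0" if "refines {1..k} \<pi> \<rho>" for \<pi>
        proof -
          have "card \<pi> = 1"
            using d_le[OF that] card_partition_le[of "{1..k}" \<pi>] that True \<open>d = k\<close>
            by (auto simp: refines_def)
          then show ?thesis
            using bdiff_falling_ratio_Suc[of 0 1 N] N True \<open>d = k\<close> by simp
        qed
        then show ?thesis
          using centered_Wg_as_differences[of d k \<sigma> \<tau> \<rho> N] assms(2,5,6) d_le N True
          by simp
      qed
      moreover have "a_tilde k N = 0" for N
        using True by (simp add: a_tilde_def)
      ultimately show ?thesis
        unfolding rel_asymp_from_def by (intro exI[of _ "\<lambda>_. 0"]) simp
    qed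
  qed
  show ?thesis
  proof (intro conjI impI zero_iff top)
    assume d: "even d \<and> d \<noteq> k"
    then have "(d + 1) div 2 = d div 2" by auto
    with d show "rel_asymp_from k (centered_Wg k \<sigma> \<tau>)
        (\<lambda>N. moebius \<rho> \<sigma> * moebius \<rho> \<tau> * odd_dfact (int d - 1) *
             real N powi (- (int (card \<rho>) + int (d div 2))))"
      by (intro generic) (auto simp: diff_coeff_def)
  next
    assume d: "odd d \<and> d \<noteq> k"
    with d_less show "rel_asymp_from k (centered_Wg k \<sigma> \<tau>)
        (\<lambda>N. moebius \<rho> \<sigma> * moebius \<rho> \<tau> *
             (real (card \<rho>) - real d / 3 - 2 / 3) * odd_dfact (int d) *
             real N powi (- (int (card \<rho>) + int ((d + 1) div 2))))"
      by (intro generic) (auto simp: diff_coeff_def)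
  qed
qed

end
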